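(* Let $L\ge 1$ and let $n_0,\dots,n_L,d$ be positive integers. Let $\sigma:\mathbb{R}\to\mathbb{R}$ be a function (applied element-wise to vectors), and let $\mathbf W_k\in\mathbb{R}^{n_k\times n_{k-1}}$, $\mathbf U_k\in\mathbb{R}^{n_k\times d}$, $\mathbf b_k\in\mathbb{R}^{n_k}$ for $k=1,\dots,L$. Let $m\ge 2\max\{n_k: k=0,\dots,L\}$ be an integer. Then there exist matrices $\overline{\mathbf W}_k\in\mathbb{R}^{n_k\times m}$, $k=0,\dots,L$, such that for every $\mathbf x\in\mathbb{R}^d$ and every initial state $\mathbf z_1\in\mathbb{R}^{n_0}$ the output $\mathbf y$ of the network $$\mathbf z_{k+1}=\sigma(\mathbf W_k\mathbf z_k+\mathbf U_k\mathbf x+\mathbf b_k),\quad k=1,\dots,L-1,\qquad \mathbf y=\mathbf W_L\mathbf z_L,$$ equals the output of the network $$\overline{\mathbf z}_1=\overline{\mathbf W}_0^\top\mathbf z_1,\qquad \overline{\mathbf z}_{k+1}=\overline{\mathbf W}_k^\top\sigma(\overline{\mathbf W}_k\overline{\mathbf z}_k+\mathbf U_k\mathbf x+\mathbf b_k),\quad k=1,\dots,L-1,\qquad \mathbf y=\overline{\mathbf W}_L\overline{\mathbf z}_L .$$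
   Context: All matrices are real. The second network is a rewriting of the first in which each hidden layer has the form $\overline{\mathbf z}\mapsto\overline{\mathbf W}^\top\sigma(\overline{\mathbf W}\,\overline{\mathbf z}+\mathbf U\mathbf x+\mathbf b)$ on $\mathbb{R}^m$, with the same $\mathbf U_k$ and $\mathbf b_k$. *)

theory Defs
  imports "Jordan_Normal_Form.Matrix"
begin

text \<open>
  States are numbered from \<open>1\<close> in the networks below, so that the recursion index \<open>j\<close>
  (the number of hidden layers already applied) stands for the state \<open>z\<^sub>j\<^sub>+\<^sub>1\<close>;
  the parameters \<open>W\<close>, \<open>U\<close>, \<open>b\<close> keep their original numbering.
\<close>

primrec state :: "(real \<Rightarrow> real) \<Rightarrow> (nat \<Rightarrow> real mat) \<Rightarrow> (nat \<Rightarrow> real mat) \<Rightarrow>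
    (nat \<Rightarrow> real vec) \<Rightarrow> real vec \<Rightarrow> real vec \<Rightarrow> nat \<Rightarrow> real vec" where
  "state \<sigma> W U b x z1 0 = z1"
| "state \<sigma> W U b x z1 (Suc j) =
     map_vec \<sigma> (W (Suc j) *\<^sub>v state \<sigma> W U b x z1 j + U (Suc j) *\<^sub>v x + b (Suc j))"

definition network_output :: "nat \<Rightarrow> (real \<Rightarrow> real) \<Rightarrow> (nat \<Rightarrow> real mat) \<Rightarrow> (nat \<Rightarrow> real mat) \<Rightarrow>
    (nat \<Rightarrow> real vec) \<Rightarrow> real vec \<Rightarrow> real vec \<Rightarrow> real vec" where
  "network_output L \<sigma> W U b x z1 = W L *\<^sub>v state \<sigma> W U b x z1 (L - 1)"

primrec sym_state :: "(real \<Rightarrow> real) \<Rightarrow> (nat \<Rightarrow> real mat) \<Rightarrow> (nat \<Rightarrow> real mat) \<Rightarrow>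
    (nat \<Rightarrow> real vec) \<Rightarrow> real vec \<Rightarrow> real vec \<Rightarrow> nat \<Rightarrow> real vec" where
  "sym_state \<sigma> V U b x z1 0 = transpose_mat (V 0) *\<^sub>v z1"
| "sym_state \<sigma> V U b x z1 (Suc j) =
     transpose_mat (V (Suc j)) *\<^sub>v
       map_vec \<sigma> (V (Suc j) *\<^sub>v sym_state \<sigma> V U b x z1 j + U (Suc j) *\<^sub>v x + b (Suc j))"

definition sym_network_output :: "nat \<Rightarrow> (real \<Rightarrow> real) \<Rightarrow> (nat \<Rightarrow> real mat) \<Rightarrow> (nat \<Rightarrow> real mat) \<Rightarrow>
    (nat \<Rightarrow> real vec) \<Rightarrow> real vec \<Rightarrow> real vec \<Rightarrow> real vec" where
  "sym_network_output L \<sigma> V U b x z1 = V L *\<^sub>v sym_state \<sigma> V U b x z1 (L - 1)"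

end

theory Submission imports Defs begin

text \<open>
  If \<open>V\<^sub>k V\<^sub>k\<^sub>-\<^sub>1\<^sup>T = W\<^sub>k\<close> for all \<open>k\<close>, then the states of the second network are
  \<open>V\<^sub>k\<^sup>T\<close> applied to those of the first, so the outputs agree. To solve these equations, split
  \<open>2 N\<close> of the \<open>m\<close> columns, \<open>N = max n\<^sub>k\<close>, into two halves. Put the (padded) identity into one half
  of \<open>V\<^sub>k\<close>, alternating with the parity of \<open>k\<close>, and a correction \<open>X\<^sub>k\<close> into the other.
  Then \<open>V\<^sub>k V\<^sub>k\<^sub>-\<^sub>1\<^sup>T = X\<^sub>k + X\<^sub>k\<^sub>-\<^sub>1\<^sup>T\<close>, which determines \<open>X\<^sub>k\<close> recursively.
\<close>

text \<open>Unrolled, this is the alternating sum of \<open>W k\<close>, the transpose of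
  \<open>W (k - 1)\<close>, \<open>W (k - 2)\<close> and so on. As a function on all index pairs it
  avoids padding when layer widths differ. Values outside the range of \<open>W k\<close> are
  unspecified, but they cancel or meet a zero in the products below.\<close>

primrec correction :: "(nat \<Rightarrow> 'a :: ab_group_add mat) \<Rightarrow> nat \<Rightarrow> nat \<Rightarrow> nat \<Rightarrow> 'a" where
  "correction W 0 i j = 0"
| "correction W (Suc k) i j = W (Suc k) $$ (i, j) - correction W k j i"

definition sym_weight :: "nat \<Rightarrow> nat \<Rightarrow> (nat \<Rightarrow> nat) \<Rightarrow> (nat \<Rightarrow> 'a :: ring_1 mat) \<Rightarrow> nat \<Rightarrow> 'a mat" where
  "sym_weight N m n W k = mat (n k) m (\<lambda>(i, c).
     if c < N then (if even k then of_bool (i = c) else correction W k i c)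
     else if c < 2 * N then (if even k then correction W k i (c - N) else of_bool (i = c - N))
     else 0)"

lemma sym_weight_carrier [simp]: "sym_weight N m n W k \<in> carrier_mat (n k) m"
  by (simp add: sym_weight_def)

lemma sum_two_halves:
  fixes f :: "nat \<Rightarrow> 'a :: comm_monoid_add"
  assumes "2 * N \<le> m" and "\<And>c. 2 * N \<le> c \<Longrightarrow> c < m \<Longrightarrow> f c = 0"
  shows "(\<Sum>c = 0..<m. f c) = (\<Sum>c<N. f c) + (\<Sum>c<N. f (N + c))"
proof -
  have "(\<Sum>c = 0..<m. f c) = (\<Sum>c = 0..<2 * N. f c)"
    by (rule sum.mono_neutral_right) (use assms in auto)
  also have "\<dots> = (\<Sum>c = 0..<N. f c) + (\<Sum>c = N..<2 * N. f c)"
    by (simp add: sum.atLeastLessThan_concat)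
  also have "(\<Sum>c = N..<2 * N. f c) = (\<Sum>c<N. f (N + c))"
    using sum.shift_bounds_nat_ivl[of f 0 N N]
    by (simp add: mult_2 lessThan_atLeast0 add.commute)
  finally show ?thesis by (simp add: lessThan_atLeast0)
qed

text \<open>Both orders occur: the parity of \<open>k\<close> and the choice of half decide on which
  side the identity stands, and the ring need not be commutative.\<close>

lemma sum_of_bool_mult:
  fixes f :: "nat \<Rightarrow> 'a :: ring_1"
  assumes "i < N"
  shows "(\<Sum>c<N. of_bool (i = c) * f c) = f i" "(\<Sum>c<N. f c * of_bool (i = c)) = f i"
  using assms by (simp_all add: of_bool_def if_distrib if_distribR cong: if_cong)

lemma sym_weight_mult_transpose:
  fixes W :: "nat \<Rightarrow> 'a :: ring_1 mat"
  assumes W: "W (Suc k) \<in> carrier_mat (n (Suc k)) (n k)"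
    and N: "n k \<le> N" "n (Suc k) \<le> N" and m: "2 * N \<le> m"
  shows "sym_weight N m n W (Suc k) * transpose_mat (sym_weight N m n W k) = W (Suc k)"
    (is "?A * transpose_mat ?B = _")
proof (rule eq_matI)
  fix i j assume "i < dim_row (W (Suc k))" "j < dim_col (W (Suc k))"
  hence ij: "i < n (Suc k)" "j < n k" "i < N" "j < N" using W N by auto
  have "(?A * transpose_mat ?B) $$ (i, j) = (\<Sum>c = 0..<m. ?A $$ (i, c) * ?B $$ (j, c))"
    using ij by (simp add: sym_weight_def scalar_prod_def)
  also have "\<dots> = (\<Sum>c<N. ?A $$ (i, c) * ?B $$ (j, c)) + (\<Sum>c<N. ?A $$ (i, N + c) * ?B $$ (j, N + c))"
    using ij m by (intro sum_two_halves) (auto simp: sym_weight_def)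
  \<comment> \<open>In each half exactly one factor is an identity row, so it picks a single
    correction entry. The recursion stays folded until both entries are added and the
    \<open>correction W k j i\<close> terms cancel.\<close>
  also have "(\<Sum>c<N. ?A $$ (i, c) * ?B $$ (j, c)) =
      (if even k then correction W (Suc k) i j else correction W k j i)"
    using ij m by (simp add: sym_weight_def sum_of_bool_mult del: correction.simps)
  also have "(\<Sum>c<N. ?A $$ (i, N + c) * ?B $$ (j, N + c)) =
      (if even k then correction W k j i else correction W (Suc k) i j)"
    using ij m by (simp add: sym_weight_def sum_of_bool_mult del: correction.simps)
  finally show "(?A * transpose_mat ?B) $$ (i, j) = W (Suc k) $$ (i, j)"
    by (simp split: if_splits)
qed (use W in \<open>auto simp: sym_weight_def\<close>)

lemma state_carrier:
  assumes "\<forall>k\<in>{1..j}. W k \<in> carrier_mat (n k) (n (k - 1))"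
    and "\<forall>k\<in>{1..j}. b k \<in> carrier_vec (n k)" and "z1 \<in> carrier_vec (n 0)"
  shows "state \<sigma> W U b x z1 j \<in> carrier_vec (n j)"
proof (cases j)
  case (Suc l)
  \<comment> \<open>A vector sum takes the dimension of its right summand, here the bias.\<close>
  hence "dim_vec (b (Suc l)) = n (Suc l)" using assms(2) by auto
  thus ?thesis using Suc by (intro carrier_vecI) simp
qed (use assms in simp)

text \<open>The arguments of \<open>\<sigma>\<close> agree layer by layer, since
  \<open>V (Suc j)\<close> times the transpose of \<open>V j\<close> restores
  \<open>W (Suc j)\<close>; hence \<open>\<sigma>\<close> can be arbitrary.\<close>

lemma sym_state_eq:
  assumes "\<forall>k\<in>{1..j}. W k \<in> carrier_mat (n k) (n (k - 1))"
    and "\<forall>k\<in>{1..j}. b k \<in> carrier_vec (n k)" and "z1 \<in> carrier_vec (n 0)"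
    and "\<forall>k\<in>{0..j}. V k \<in> carrier_mat (n k) m"
    and "\<forall>k\<in>{1..j}. V k * transpose_mat (V (k - 1)) = W k"
  shows "sym_state \<sigma> V U b x z1 j = transpose_mat (V j) *\<^sub>v state \<sigma> W U b x z1 j"
  using assms
proof (induction j)
  case (Suc j)
  have "V (Suc j) *\<^sub>v sym_state \<sigma> V U b x z1 j =
      V (Suc j) *\<^sub>v (transpose_mat (V j) *\<^sub>v state \<sigma> W U b x z1 j)"
    using Suc by simp
  also have "\<dots> = (V (Suc j) * transpose_mat (V j)) *\<^sub>v state \<sigma> W U b x z1 j"
    using Suc.prems state_carrier[of j W n b z1 \<sigma> U x]
    by (intro assoc_mult_mat_vec[symmetric, of _ "n (Suc j)" m _ "n j"]) auto
  also have "V (Suc j) * transpose_mat (V j) = W (Suc j)"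
    using bspec[OF Suc.prems(5), of "Suc j"] by simp
  finally show ?case by simp
qed simp

lemma sym_network_output_eq:
  assumes "L \<ge> 1"
    and "\<forall>k\<in>{1..L}. W k \<in> carrier_mat (n k) (n (k - 1))"
    and "\<forall>k\<in>{1..L}. b k \<in> carrier_vec (n k)" and "z1 \<in> carrier_vec (n 0)"
    and "\<forall>k\<in>{0..L}. V k \<in> carrier_mat (n k) m"
    and "\<forall>k\<in>{1..L}. V k * transpose_mat (V (k - 1)) = W k"
  shows "sym_network_output L \<sigma> V U b x z1 = network_output L \<sigma> W U b x z1"
proof -
  let ?z = "state \<sigma> W U b x z1 (L - 1)"
  have "sym_network_output L \<sigma> V U b x z1 = V L *\<^sub>v (transpose_mat (V (L - 1)) *\<^sub>v ?z)"
    unfolding sym_network_output_def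
    by (subst sym_state_eq[of "L - 1" W n b z1 V m]) (use assms in auto)
  also have "\<dots> = (V L * transpose_mat (V (L - 1))) *\<^sub>v ?z"
    using assms state_carrier[of "L - 1" W n b z1 \<sigma> U x, OF _ _ assms(4)]
    by (intro assoc_mult_mat_vec[symmetric, of _ "n L" m _ "n (L - 1)"]) force+
  finally show ?thesis using assms by (simp add: network_output_def)
qed

theorem lemma1:
  fixes L d m :: nat and n :: "nat \<Rightarrow> nat" and \<sigma> :: "real \<Rightarrow> real"
    and W U :: "nat \<Rightarrow> real mat" and b :: "nat \<Rightarrow> real vec"
  assumes "L \<ge> 1"
    and "\<forall>k\<in>{0..L}. n k > 0"
    and "d > 0"
    and "\<forall>k\<in>{1..L}. W k \<in> carrier_mat (n k) (n (k - 1))"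
    and "\<forall>k\<in>{1..L}. U k \<in> carrier_mat (n k) d"
    and "\<forall>k\<in>{1..L}. b k \<in> carrier_vec (n k)"
    and "m \<ge> 2 * Max (n ` {0..L})"
  shows "\<exists>V :: nat \<Rightarrow> real mat.
           (\<forall>k\<in>{0..L}. V k \<in> carrier_mat (n k) m) \<and>
           (\<forall>x\<in>carrier_vec d. \<forall>z1\<in>carrier_vec (n 0).
              network_output L \<sigma> W U b x z1 = sym_network_output L \<sigma> V U b x z1)"
proof -
  \<comment> \<open>A half of this width has room for the identity of every layer. The witness
    \<open>?V\<close> is built without \<open>x\<close> and \<open>z1\<close>, so it serves all
    inputs.\<close>
  let ?N = "Max (n ` {0..L})"
  let ?V = "sym_weight ?N m n W"
  have "?V k * transpose_mat (?V (k - 1)) = W k" if k: "k \<in> {1..L}" for k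
  proof -
    obtain l where l: "k = Suc l" using k by (cases k) auto
    have "n l \<le> ?N" "n (Suc l) \<le> ?N" using k l by auto
    moreover have "W (Suc l) \<in> carrier_mat (n (Suc l)) (n l)" using assms(4) k l by force
    ultimately show ?thesis using assms(7) l by (simp add: sym_weight_mult_transpose)
  qed
  hence "network_output L \<sigma> W U b x z1 = sym_network_output L \<sigma> ?V U b x z1"
    if "z1 \<in> carrier_vec (n 0)" for x z1
    using assms that by (intro sym_network_output_eq[symmetric, where m = m]) auto
  thus ?thesis by (intro exI[of _ ?V]) simp
qed

end
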